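(* Let $(A,\circ,[\cdot,\cdot])$ be a finite-dimensional GD algebra over $\Bbbk$. Then $A$ is solvable (as a GD algebra) if and only if the Novikov algebra $(A,\circ)$ is solvable and $\mathcal S_m(A)=0$ for some $m\ge 0$.
   Context: $\Bbbk$ is an algebraically closed field of characteristic $0$. A Novikov algebra is a vector space with a bilinear product $\circ$ satisfying $(x\circ y)\circ z-x\circ(y\circ z)=(y\circ x)\circ z-y\circ(x\circ z)$ and $(x\circ y)\circ z=(x\circ z)\circ y$. A Gelfand--Dorfman (GD) algebra is a triple $(A,\circ,[\cdot,\cdot])$ such that $(A,\circ)$ is a Novikov algebra, $(A,[\cdot,\cdot])$ is a Lie algebra, and for all $x,y,z\in A$: $[x,y\circ z]-[z,y\circ x]+[y,x]\circ z-[y,z]\circ x-y\circ[x,z]=0$. The GD derived series is $A^{(0)}=A$, $A^{(n+1)}=A^{(n)}\circ A^{(n)}+[A^{(n)},A^{(n)}]$ (linear spans); $A$ is solvable if $A^{(N)}=0$ for some $N\ge0$. The Novikov algebra $(A,\circ)$ is solvable if the analogous series using only $\circ$ reaches $0$. Put $\delta(x,y)=x\circ y-y\circ x$; for a subspace $U$, $\delta(U,U)$ and $[U,U]$ denote the linear spans of the values. The skew-derived tower of $A$ is $\mathcal S_0(A)=A$, $\mathcal S_{n+1}(A)=[\mathcal S_n(A),\mathcal S_n(A)]+\delta(\mathcal S_n(A),\mathcal S_n(A))$. *)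

theory Defs
  imports "HOL-Computational_Algebra.Polynomial" "HOL-Library.Set_Algebras"
begin

text \<open>
  An algebra is a type \<open>'b\<close> with a scalar multiplication \<open>scale\<close>, as in the library's locale
  \<open>vector_space\<close>; subspaces are sets, and \<open>U + V\<close> on sets is the pointwise (Minkowski) sum.
\<close>

definition bilinear_op ::
  "('a::field \<Rightarrow> 'b::ab_group_add \<Rightarrow> 'b) \<Rightarrow> ('b \<Rightarrow> 'b \<Rightarrow> 'b) \<Rightarrow> bool" where
  "bilinear_op scale f \<longleftrightarrow>
     (\<forall>x. Vector_Spaces.linear scale scale (\<lambda>y. f x y)) \<and>
     (\<forall>y. Vector_Spaces.linear scale scale (\<lambda>x. f x y))"

locale novikov_algebra = vector_space scale
  for scale :: "'a::field \<Rightarrow> 'b::ab_group_add \<Rightarrow> 'b" +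
  fixes circ :: "'b \<Rightarrow> 'b \<Rightarrow> 'b"  (infixl \<open>\<circ>\<^sub>N\<close> 70)
  assumes circ_bilinear: "bilinear_op scale circ"
    and left_symmetric:
      "(x \<circ>\<^sub>N y) \<circ>\<^sub>N z - x \<circ>\<^sub>N (y \<circ>\<^sub>N z) = (y \<circ>\<^sub>N x) \<circ>\<^sub>N z - y \<circ>\<^sub>N (x \<circ>\<^sub>N z)"
    and right_commutative: "(x \<circ>\<^sub>N y) \<circ>\<^sub>N z = (x \<circ>\<^sub>N z) \<circ>\<^sub>N y"

locale lie_algebra = vector_space scale
  for scale :: "'a::field \<Rightarrow> 'b::ab_group_add \<Rightarrow> 'b" +
  fixes bracket :: "'b \<Rightarrow> 'b \<Rightarrow> 'b"
  assumes bracket_bilinear: "bilinear_op scale bracket"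
    and bracket_self: "bracket x x = 0"
    and jacobi:
      "bracket x (bracket y z) + bracket y (bracket z x) + bracket z (bracket x y) = 0"

locale gd_algebra = novikov_algebra scale circ + lie_algebra scale bracket
  for scale :: "'a::field \<Rightarrow> 'b::ab_group_add \<Rightarrow> 'b"
    and circ :: "'b \<Rightarrow> 'b \<Rightarrow> 'b"  (infixl \<open>\<circ>\<^sub>N\<close> 70)
    and bracket :: "'b \<Rightarrow> 'b \<Rightarrow> 'b" +
  assumes gd_compat:
    "bracket x (y \<circ>\<^sub>N z) - bracket z (y \<circ>\<^sub>N x) + bracket y x \<circ>\<^sub>N z
       - bracket y z \<circ>\<^sub>N x - y \<circ>\<^sub>N bracket x z = 0"

definition span_prod ::
  "('a::field \<Rightarrow> 'b::ab_group_add \<Rightarrow> 'b) \<Rightarrow> ('b \<Rightarrow> 'b \<Rightarrow> 'b) \<Rightarrow> 'b set \<Rightarrow> 'b set \<Rightarrow> 'b set" where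
  "span_prod scale f U V = module.span scale {f x y |x y. x \<in> U \<and> y \<in> V}"

primrec gd_derived ::
  "('a::field \<Rightarrow> 'b::ab_group_add \<Rightarrow> 'b) \<Rightarrow> ('b \<Rightarrow> 'b \<Rightarrow> 'b) \<Rightarrow> ('b \<Rightarrow> 'b \<Rightarrow> 'b) \<Rightarrow> nat \<Rightarrow> 'b set"
where
  "gd_derived scale circ bracket 0 = UNIV"
| "gd_derived scale circ bracket (Suc n) =
     span_prod scale circ (gd_derived scale circ bracket n) (gd_derived scale circ bracket n) +
     span_prod scale bracket (gd_derived scale circ bracket n) (gd_derived scale circ bracket n)"

definition gd_solvable ::
  "('a::field \<Rightarrow> 'b::ab_group_add \<Rightarrow> 'b) \<Rightarrow> ('b \<Rightarrow> 'b \<Rightarrow> 'b) \<Rightarrow> ('b \<Rightarrow> 'b \<Rightarrow> 'b) \<Rightarrow> bool" where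
  "gd_solvable scale circ bracket \<longleftrightarrow> (\<exists>N. gd_derived scale circ bracket N = {0})"

primrec novikov_derived ::
  "('a::field \<Rightarrow> 'b::ab_group_add \<Rightarrow> 'b) \<Rightarrow> ('b \<Rightarrow> 'b \<Rightarrow> 'b) \<Rightarrow> nat \<Rightarrow> 'b set" where
  "novikov_derived scale circ 0 = UNIV"
| "novikov_derived scale circ (Suc n) =
     span_prod scale circ (novikov_derived scale circ n) (novikov_derived scale circ n)"

definition novikov_solvable ::
  "('a::field \<Rightarrow> 'b::ab_group_add \<Rightarrow> 'b) \<Rightarrow> ('b \<Rightarrow> 'b \<Rightarrow> 'b) \<Rightarrow> bool" where
  "novikov_solvable scale circ \<longleftrightarrow> (\<exists>N. novikov_derived scale circ N = {0})"

definition skew :: "('b::ab_group_add \<Rightarrow> 'b \<Rightarrow> 'b) \<Rightarrow> 'b \<Rightarrow> 'b \<Rightarrow> 'b" where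
  "skew circ x y = circ x y - circ y x"

primrec skew_tower ::
  "('a::field \<Rightarrow> 'b::ab_group_add \<Rightarrow> 'b) \<Rightarrow> ('b \<Rightarrow> 'b \<Rightarrow> 'b) \<Rightarrow> ('b \<Rightarrow> 'b \<Rightarrow> 'b) \<Rightarrow> nat \<Rightarrow> 'b set"
where
  "skew_tower scale circ bracket 0 = UNIV"
| "skew_tower scale circ bracket (Suc n) =
     span_prod scale bracket (skew_tower scale circ bracket n) (skew_tower scale circ bracket n) +
     span_prod scale (skew circ) (skew_tower scale circ bracket n) (skew_tower scale circ bracket n)"

end

theory Submission
  imports Defs
begin

text \<open>
  One direction is monotonicity: both the Novikov derived series and the skew-derived tower
  lie inside the GD derived series term by term.

  For the other direction, the GD derived series of a finite-dimensional algebra becomes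
  stationary at some \<open>B\<close>, so that \<open>B = B \<circ> B + [B,B]\<close>, and it has to be shown that \<open>B = 0\<close>.
  Put \<open>S = [B,B] + \<delta>(B,B)\<close>. Modulo the subspace \<open>S\<close> the product \<open>x \<circ> y\<close> is a symmetric
  bilinear map on \<open>B\<close> (with values in \<open>B / S\<close>), and the defining identities make it very
  degenerate. Left symmetry together with right commutativity gives
  \<open>2 \<delta>(x,y) \<circ> z \<in> S\<close>, and the GD compatibility condition, antisymmetrised, gives
  \<open>2 [x,y] \<circ> z \<in> S\<close>. Hence the radical \<open>K = {x \<in> B. x \<circ> B \<subseteq> S}\<close> of this map contains
  \<open>[B,B]\<close> (\<open>bracket_circ_in_skew_part\<close>), and it absorbs products with \<open>B\<close>
  (\<open>radical_absorbs\<close>).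

  So \<open>B\<close> equals \<open>B \<circ> B\<close> up to \<open>K\<close>, and feeding this into itself, \<open>B\<close> equals any term of the
  Novikov derived series up to \<open>K\<close>. If \<open>(A,\<circ>)\<close> is solvable, then \<open>B = K\<close>, so that
  \<open>B \<circ> B \<subseteq> S\<close> and therefore \<open>B = S\<close> (\<open>perfect_imp_skew_perfect\<close>). A subspace with
  \<open>B \<subseteq> [B,B] + \<delta>(B,B)\<close> lies in every term of the skew-derived tower, and so vanishes as soon
  as the tower reaches \<open>0\<close>.
\<close>

text \<open>
  The GD derived series and the skew-derived tower iterate this operation for different pairs of
  products. One span of a union, instead of a sum of two spans, makes it visibly the least
  subspace containing the values of both products.
\<close>

definition op_span ::
  "('a::field \<Rightarrow> 'b::ab_group_add \<Rightarrow> 'b) \<Rightarrow> ('b \<Rightarrow> 'b \<Rightarrow> 'b) \<Rightarrow> ('b \<Rightarrow> 'b \<Rightarrow> 'b) \<Rightarrow> 'b set \<Rightarrow> 'b set"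
where
  "op_span scale f g U =
     module.span scale ({f x y |x y. x \<in> U \<and> y \<in> U} \<union> {g x y |x y. x \<in> U \<and> y \<in> U})"

context vector_space
begin

lemma op_span_eq_sum: "op_span scale f g U = span_prod scale f U U + span_prod scale g U U"
  unfolding op_span_def span_prod_def span_Un set_plus_def by blast

lemma subspace_op_span: "subspace (op_span scale f g U)"
  unfolding op_span_def by (rule subspace_span)

lemma op_span_left: "x \<in> U \<Longrightarrow> y \<in> U \<Longrightarrow> f x y \<in> op_span scale f g U"
  unfolding op_span_def by (rule span_base) blast

lemma op_span_right: "x \<in> U \<Longrightarrow> y \<in> U \<Longrightarrow> g x y \<in> op_span scale f g U"
  unfolding op_span_def by (rule span_base) blast

lemma op_span_least:
  assumes "subspace T"
    and "\<And>x y. x \<in> U \<Longrightarrow> y \<in> U \<Longrightarrow> f x y \<in> T"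
    and "\<And>x y. x \<in> U \<Longrightarrow> y \<in> U \<Longrightarrow> g x y \<in> T"
  shows "op_span scale f g U \<subseteq> T"
  unfolding op_span_def by (rule span_minimal) (use assms in auto)

lemma op_span_mono: "U \<subseteq> V \<Longrightarrow> op_span scale f g U \<subseteq> op_span scale f g V"
  by (rule op_span_least) (auto intro: subspace_op_span op_span_left op_span_right)

lemma span_prod_subset_op_span: "U \<subseteq> V \<Longrightarrow> span_prod scale f U U \<subseteq> op_span scale f g V"
  unfolding span_prod_def op_span_def by (rule span_mono) blast

lemma gd_derived_Suc:
  "gd_derived scale f g (Suc n) = op_span scale f g (gd_derived scale f g n)"
  by (simp add: op_span_eq_sum)

lemma skew_tower_Suc:
  "skew_tower scale f g (Suc n) = op_span scale g (skew f) (skew_tower scale f g n)"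
  by (simp add: op_span_eq_sum)

lemma subspace_gd_derived: "subspace (gd_derived scale f g n)"
  by (cases n) (simp_all add: gd_derived_Suc subspace_op_span subspace_UNIV del: gd_derived.simps(2))

lemma subspace_novikov_derived: "subspace (novikov_derived scale f n)"
  by (cases n) (simp_all add: span_prod_def subspace_span subspace_UNIV)

lemma subspace_skew_tower: "subspace (skew_tower scale f g n)"
  by (cases n) (simp_all add: skew_tower_Suc subspace_op_span subspace_UNIV del: skew_tower.simps(2))

lemma gd_derived_Suc_subset: "gd_derived scale f g (Suc n) \<subseteq> gd_derived scale f g n"
proof (induction n)
  case (Suc n)
  then show ?case
    using op_span_mono gd_derived_Suc by metis
qed simp

lemma novikov_derived_subset_gd_derived: "novikov_derived scale f n \<subseteq> gd_derived scale f g n"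
proof (induction n)
  case (Suc n)
  then show ?case
    unfolding gd_derived_Suc novikov_derived.simps by (rule span_prod_subset_op_span)
qed simp

lemma skew_tower_subset_gd_derived: "skew_tower scale f g n \<subseteq> gd_derived scale f g n"
proof (induction n)
  case (Suc n)
  have "op_span scale g (skew f) (gd_derived scale f g n) \<subseteq> op_span scale f g (gd_derived scale f g n)"
    by (rule op_span_least)
      (auto simp: skew_def intro!: subspace_op_span op_span_left op_span_right subspace_diff)
  with op_span_mono[OF Suc] show ?case
    unfolding gd_derived_Suc skew_tower_Suc by blast
qed simp

lemma skew_perfect_subset_skew_tower:
  assumes "B \<subseteq> op_span scale g (skew f) B"
  shows "B \<subseteq> skew_tower scale f g m"
proof (induction m)
  case (Suc m)
  with assms op_span_mono show ?case
    unfolding skew_tower_Suc by blast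
qed simp

lemma subspace_halve:
  assumes "(2::'a) \<noteq> 0" "subspace S" "u + u \<in> S"
  shows "u \<in> S"
proof -
  have "scale (1/2) (u + u) \<in> S"
    using assms(2,3) by (rule subspace_scale)
  moreover have "u + u = scale 2 u"
    using scale_left_distrib[of 1 1 u] by simp
  ultimately show ?thesis
    using assms(1) by simp
qed

end

context gd_algebra
begin

lemma
  shows circ_add_right: "x \<circ>\<^sub>N (y + z) = x \<circ>\<^sub>N y + x \<circ>\<^sub>N z"
    and circ_add_left: "(x + y) \<circ>\<^sub>N z = x \<circ>\<^sub>N z + y \<circ>\<^sub>N z"
    and circ_scale_left: "scale c x \<circ>\<^sub>N y = scale c (x \<circ>\<^sub>N y)"
proof -
  have r: "Vector_Spaces.linear scale scale (\<lambda>y. x \<circ>\<^sub>N y)" for x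
    using circ_bilinear unfolding bilinear_op_def by blast
  have l: "Vector_Spaces.linear scale scale (\<lambda>x. x \<circ>\<^sub>N y)" for y
    using circ_bilinear unfolding bilinear_op_def by blast
  interpret r: Vector_Spaces.linear scale scale "\<lambda>y. x \<circ>\<^sub>N y" by (rule r)
  show "x \<circ>\<^sub>N (y + z) = x \<circ>\<^sub>N y + x \<circ>\<^sub>N z" by (rule r.add)
  interpret l: Vector_Spaces.linear scale scale "\<lambda>x. x \<circ>\<^sub>N z" by (rule l)
  show "(x + y) \<circ>\<^sub>N z = x \<circ>\<^sub>N z + y \<circ>\<^sub>N z" by (rule l.add)
  interpret ly: Vector_Spaces.linear scale scale "\<lambda>x. x \<circ>\<^sub>N y" by (rule l)
  show "scale c x \<circ>\<^sub>N y = scale c (x \<circ>\<^sub>N y)" by (rule ly.scale)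
qed

lemma circ_zero_left: "0 \<circ>\<^sub>N y = 0"
  using circ_add_left[of 0 0 y] by simp

lemma circ_minus_left: "(- x) \<circ>\<^sub>N y = - (x \<circ>\<^sub>N y)"
  using circ_add_left[of x "- x" y] by (simp add: circ_zero_left eq_neg_iff_add_eq_0 add.commute)

lemma circ_diff_left: "(x - y) \<circ>\<^sub>N z = x \<circ>\<^sub>N z - y \<circ>\<^sub>N z"
  using circ_add_left[of "x - y" y z] by simp

lemma bracket_antisym: "bracket y x = - bracket x y"
proof -
  have r: "bracket x (y + z) = bracket x y + bracket x z" for x y z
    using bracket_bilinear unfolding bilinear_op_def
    by (metis Vector_Spaces.linear.axioms(3) module_hom.add linear_iff_module_hom)
  have l: "bracket (x + y) z = bracket x z + bracket y z" for x y z
    using bracket_bilinear unfolding bilinear_op_def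
    by (metis (no_types, lifting) module_hom.add linear_iff_module_hom)
  have "bracket (x + y) (x + y) = bracket x y + bracket y x"
    unfolding l r by (simp add: bracket_self)
  then show ?thesis
    by (simp add: bracket_self eq_neg_iff_add_eq_0 add.commute)
qed

text \<open>
  Modulo \<open>S\<close> the outer product in \<open>x \<circ> (y \<circ> z)\<close> may be reversed, and right commutativity then
  turns the right-hand side of
  \<open>\<delta>(x,y) \<circ> z = x \<circ> (y \<circ> z) - y \<circ> (x \<circ> z)\<close> into the negative of the left-hand side.
\<close>

lemma skew_circ_in_skew_part:
  assumes "(2::'a) \<noteq> 0"
    and S: "subspace S" "\<And>x y. x \<in> B \<Longrightarrow> y \<in> B \<Longrightarrow> skew circ x y \<in> S"
    and B: "\<And>x y. x \<in> B \<Longrightarrow> y \<in> B \<Longrightarrow> x \<circ>\<^sub>N y \<in> B"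
    and "x \<in> B" "y \<in> B" "z \<in> B"
  shows "skew circ x y \<circ>\<^sub>N z \<in> S"
proof (rule subspace_halve[OF assms(1) S(1)])
  have "skew circ x (y \<circ>\<^sub>N z) - skew circ y (x \<circ>\<^sub>N z) \<in> S"
    using assms by (intro subspace_diff) auto
  also have "skew circ x (y \<circ>\<^sub>N z) - skew circ y (x \<circ>\<^sub>N z)
      = skew circ x y \<circ>\<^sub>N z + skew circ x y \<circ>\<^sub>N z"
    using left_symmetric[of x y z] right_commutative[of y z x] right_commutative[of x z y]
    by (simp add: skew_def circ_diff_left algebra_simps)
  finally show "skew circ x y \<circ>\<^sub>N z + skew circ x y \<circ>\<^sub>N z \<in> S" .
qed

text \<open>
  Modulo \<open>S\<close> the compatibility condition reads
  \<open>[y,x] \<circ> z = [y,z] \<circ> x + [x,z] \<circ> y\<close>. The left-hand side is antisymmetric in \<open>x\<close> and \<open>y\<close>, the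
  right-hand side is symmetric.
\<close>

lemma bracket_circ_in_skew_part:
  assumes "(2::'a) \<noteq> 0"
    and S: "subspace S" "\<And>x y. x \<in> B \<Longrightarrow> y \<in> B \<Longrightarrow> skew circ x y \<in> S"
      "\<And>x y. x \<in> B \<Longrightarrow> y \<in> B \<Longrightarrow> bracket x y \<in> S"
    and B: "\<And>x y. x \<in> B \<Longrightarrow> y \<in> B \<Longrightarrow> x \<circ>\<^sub>N y \<in> B"
      "\<And>x y. x \<in> B \<Longrightarrow> y \<in> B \<Longrightarrow> bracket x y \<in> B"
    and "x \<in> B" "y \<in> B" "z \<in> B"
  shows "bracket x y \<circ>\<^sub>N z \<in> S"
proof (rule subspace_halve[OF assms(1) S(1)])
  have sym: "bracket b a \<circ>\<^sub>N z - bracket b z \<circ>\<^sub>N a - bracket a z \<circ>\<^sub>N b \<in> S"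
    if "a \<in> B" "b \<in> B" for a b
  proof -
    have "skew circ b (bracket a z) - bracket a (b \<circ>\<^sub>N z) + bracket z (b \<circ>\<^sub>N a) \<in> S"
      using assms that by (intro subspace_add subspace_diff) auto
    also have "skew circ b (bracket a z) - bracket a (b \<circ>\<^sub>N z) + bracket z (b \<circ>\<^sub>N a)
        = bracket b a \<circ>\<^sub>N z - bracket b z \<circ>\<^sub>N a - bracket a z \<circ>\<^sub>N b"
      using gd_compat[of a b z] by (simp add: skew_def algebra_simps)
    finally show ?thesis .
  qed
  have "bracket x y \<circ>\<^sub>N z - bracket x z \<circ>\<^sub>N y - bracket y z \<circ>\<^sub>N x
      - (bracket y x \<circ>\<^sub>N z - bracket y z \<circ>\<^sub>N x - bracket x z \<circ>\<^sub>N y) \<in> S"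
    using subspace_diff[OF S(1) sym[of y x] sym[of x y]] assms by simp
  then show "bracket x y \<circ>\<^sub>N z + bracket x y \<circ>\<^sub>N z \<in> S"
    by (simp add: bracket_antisym[of y x] circ_minus_left algebra_simps)
qed

text \<open>
  The radical is an ideal because \<open>(a \<circ> r) \<circ> b = (a \<circ> b) \<circ> r\<close> is congruent to \<open>r \<circ> (a \<circ> b)\<close>
  modulo \<open>S\<close>, and \<open>(r \<circ> a) \<circ> b\<close> differs from \<open>(a \<circ> r) \<circ> b\<close> by \<open>\<delta>(r,a) \<circ> b\<close>, which lies in \<open>S\<close>.
\<close>

lemma radical_absorbs:
  assumes "(2::'a) \<noteq> 0"
    and S: "subspace S" "\<And>x y. x \<in> B \<Longrightarrow> y \<in> B \<Longrightarrow> skew circ x y \<in> S"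
    and B: "\<And>x y. x \<in> B \<Longrightarrow> y \<in> B \<Longrightarrow> x \<circ>\<^sub>N y \<in> B"
    and r: "r \<in> B" "\<And>y. y \<in> B \<Longrightarrow> r \<circ>\<^sub>N y \<in> S"
    and "a \<in> B" "b \<in> B"
  shows "(a \<circ>\<^sub>N r) \<circ>\<^sub>N b \<in> S" and "(r \<circ>\<^sub>N a) \<circ>\<^sub>N b \<in> S"
proof -
  have "skew circ (a \<circ>\<^sub>N b) r + r \<circ>\<^sub>N (a \<circ>\<^sub>N b) \<in> S"
    using assms by (intro subspace_add) auto
  then show ar: "(a \<circ>\<^sub>N r) \<circ>\<^sub>N b \<in> S"
    by (simp add: skew_def right_commutative[of a b r])
  have "skew circ r a \<circ>\<^sub>N b + (a \<circ>\<^sub>N r) \<circ>\<^sub>N b \<in> S"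
    using skew_circ_in_skew_part[OF assms(1) S B] S(1) r assms ar by (intro subspace_add) auto
  then show "(r \<circ>\<^sub>N a) \<circ>\<^sub>N b \<in> S"
    by (simp add: skew_def circ_diff_left)
qed

text \<open>
  The key step. Its inductive claim, that every element of \<open>B\<close> is congruent modulo the radical \<open>K\<close>
  to an element of the \<open>j\<close>-th Novikov derived space, keeps the representative inside \<open>B\<close> so that
  \<open>K\<close> still absorbs its products.
\<close>

lemma perfect_imp_skew_perfect:
  assumes two: "(2::'a) \<noteq> 0"
    and perfect: "B = op_span scale circ bracket B"
    and solvable: "novikov_solvable scale circ"
  shows "B \<subseteq> op_span scale bracket (skew circ) B"
proof -
  define S where "S = op_span scale bracket (skew circ) B"
  define K where "K = {x \<in> B. \<forall>y\<in>B. x \<circ>\<^sub>N y \<in> S}"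
  have subB: "subspace B"
    using perfect subspace_op_span by metis
  have B: "x \<circ>\<^sub>N y \<in> B" "bracket x y \<in> B" if "x \<in> B" "y \<in> B" for x y
    using that perfect op_span_left op_span_right by metis+
  have subS: "subspace S"
    unfolding S_def by (rule subspace_op_span)
  have S: "bracket x y \<in> S" "skew circ x y \<in> S" if "x \<in> B" "y \<in> B" for x y
    using that unfolding S_def by (auto intro: op_span_left op_span_right)
  have subK: "subspace K"
    using subB subS unfolding K_def subspace_def
    by (auto simp: circ_zero_left circ_add_left circ_scale_left)
  have bracket_K: "bracket x y \<in> K" if "x \<in> B" "y \<in> B" for x y
    using that B bracket_circ_in_skew_part[OF two subS S(2) S(1) B] unfolding K_def by auto
  have K_ideal: "a \<circ>\<^sub>N r \<in> K" "r \<circ>\<^sub>N a \<in> K" if "r \<in> K" "a \<in> B" for a r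
    using that B radical_absorbs[OF two subS S(2) B(1), of r a] unfolding K_def by auto
  have reduce: "B \<subseteq> (novikov_derived scale circ j \<inter> B) + K" for j
  proof (induction j)
    case 0
    have "0 \<in> K" using subK by (rule subspace_0)
    then show ?case by (force simp: set_plus_def)
  next
    case (Suc j)
    let ?D = "novikov_derived scale circ (Suc j) \<inter> B"
    have subD: "subspace ?D"
      using subspace_novikov_derived subB by (rule subspace_inter)
    have "?D + K = {x + y |x y. x \<in> ?D \<and> y \<in> K}"
      unfolding set_plus_def by blast
    with subspace_sums[OF subD subK] have sub: "subspace (?D + K)"
      by simp
    have "a \<circ>\<^sub>N b \<in> ?D + K" if ab: "a \<in> B" "b \<in> B" for a b
    proof -
      obtain d r where d: "d \<in> novikov_derived scale circ j" "d \<in> B" "r \<in> K" "a = d + r"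
        using Suc ab(1) by (auto elim!: set_plus_elim)
      obtain e q where e: "e \<in> novikov_derived scale circ j" "e \<in> B" "q \<in> K" "b = e + q"
        using Suc ab(2) by (auto elim!: set_plus_elim)
      have "d \<circ>\<^sub>N e \<in> ?D"
        using d e B unfolding novikov_derived.simps span_prod_def by (auto intro!: span_base)
      moreover have "d \<circ>\<^sub>N q + r \<circ>\<^sub>N b \<in> K"
        using K_ideal d e ab subK by (intro subspace_add) auto
      moreover have "a \<circ>\<^sub>N b = d \<circ>\<^sub>N e + (d \<circ>\<^sub>N q + r \<circ>\<^sub>N b)"
        unfolding d(4) circ_add_left by (simp add: e(4) circ_add_right add.assoc)
      ultimately show ?thesis by (metis set_plus_intro)
    qed
    moreover have "bracket a b \<in> ?D + K" if "a \<in> B" "b \<in> B" for a b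
      using set_plus_intro[OF subspace_0[OF subD] bracket_K[OF that]] by simp
    ultimately have "op_span scale circ bracket B \<subseteq> ?D + K"
      by (intro op_span_least sub)
    with perfect show ?case by simp
  qed
  obtain N where "novikov_derived scale circ N = {0}"
    using solvable unfolding novikov_solvable_def by blast
  with reduce[of N] have "B \<subseteq> K"
    by (auto elim!: set_plus_elim)
  then have "op_span scale circ bracket B \<subseteq> S"
    using S(1) subS by (intro op_span_least) (auto simp: K_def)
  with perfect show ?thesis
    unfolding S_def by simp
qed

end

text \<open>
  A strictly decreasing chain of subspaces would have dimensions decreasing forever.
\<close>

lemma (in finite_dimensional_vector_space) decreasing_subspaces_stationary:
  assumes sub: "\<And>n. subspace (U n)" and dec: "\<And>n. U (Suc n) \<subseteq> U n"
  shows "\<exists>n. U (Suc n) = U n"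
proof (rule ccontr)
  assume "\<not> ?thesis"
  then have less: "dim (U (Suc n)) < dim (U n)" for n
    using sub dec subspace_dim_equal by (metis not_le)
  have "dim (U n) + n \<le> dim (U 0)" for n
  proof (induction n)
    case (Suc n)
    with less[of n] show ?case by linarith
  qed simp
  from this[of "Suc (dim (U 0))"] show False by simp
qed

theorem theorem4p5:
  fixes scale :: "'k::{alg_closed_field, field_char_0} \<Rightarrow> 'b::ab_group_add \<Rightarrow> 'b"
    and circ bracket :: "'b \<Rightarrow> 'b \<Rightarrow> 'b"
    and Basis :: "'b set"
  assumes "gd_algebra scale circ bracket"
    and "finite_dimensional_vector_space scale Basis"
  shows "gd_solvable scale circ bracket \<longleftrightarrow>
    novikov_solvable scale circ \<and> (\<exists>m. skew_tower scale circ bracket m = {0})"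
proof -
  interpret gd_algebra scale circ bracket by fact
  interpret fd: finite_dimensional_vector_space scale Basis by fact
  show ?thesis
  proof
    assume "gd_solvable scale circ bracket"
    then obtain N where N: "gd_derived scale circ bracket N = {0}"
      unfolding gd_solvable_def by blast
    have "novikov_derived scale circ N = {0}"
      using novikov_derived_subset_gd_derived[of circ N bracket] N
        subspace_0[OF subspace_novikov_derived[of circ N]] by auto
    moreover have "skew_tower scale circ bracket N = {0}"
      using skew_tower_subset_gd_derived[of circ bracket N] N
        subspace_0[OF subspace_skew_tower[of circ bracket N]] by auto
    ultimately show "novikov_solvable scale circ \<and> (\<exists>m. skew_tower scale circ bracket m = {0})"
      unfolding novikov_solvable_def by blast
  next
    assume solvable: "novikov_solvable scale circ \<and> (\<exists>m. skew_tower scale circ bracket m = {0})"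
    then obtain m where m: "skew_tower scale circ bracket m = {0}" by blast
    obtain n where "gd_derived scale circ bracket (Suc n) = gd_derived scale circ bracket n"
      using fd.decreasing_subspaces_stationary[of "gd_derived scale circ bracket"]
        subspace_gd_derived gd_derived_Suc_subset by blast
    then have "gd_derived scale circ bracket n
        \<subseteq> op_span scale bracket (skew circ) (gd_derived scale circ bracket n)"
      using solvable gd_derived_Suc by (intro perfect_imp_skew_perfect) auto
    from skew_perfect_subset_skew_tower[OF this, of m] m
    have "gd_derived scale circ bracket n = {0}"
      using subspace_0[OF subspace_gd_derived[of circ bracket n]] by auto
    then show "gd_solvable scale circ bracket"
      unfolding gd_solvable_def by blast
  qed
qed

end
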